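(* Let $P$ be a poset and $T:=\mathcal{I}(P)$ the lattice of initial segments of $P$ ordered by inclusion. Then the following are equivalent: (i) $T$ has the selection property for convex sublattices (CLSP); (ii) $T$ has the fixed point property for convex sublattices (CLFPP); (iii) $\mathcal{C}_{L}(T)$ is a complete lattice; (iv) $P$ has no infinite antichain.
   Context: An initial segment of $P$ is a subset $A$ (possibly empty) such that $x\le y\in A$ implies $x\in A$. For nonempty subsets $X,Y$ of a poset, the bi-dominating order is: $X\le Y$ iff every element of $X$ is below some element of $Y$ and every element of $Y$ is above some element of $X$. For a lattice $T$, $\mathcal{C}_{L}(T)$ is the set of nonempty convex sublattices of $T$ with this order (it is a partial order there). $T$ has CLFPP if every map $f:T\to\mathcal{C}_L(T)$ with $x\le y\Rightarrow f(x)\le f(y)$ has a fixed point, i.e. some $x\in T$ with $x\in f(x)$. $T$ has CLSP if there is an order preserving map $\varphi:\mathcal{C}_L(T)\to T$ with $\varphi(X)\in X$ for all $X\in\mathcal{C}_L(T)$. *)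

theory Defs
  imports "HOL-Algebra.Complete_Lattice"
begin

definition initial_segments :: "('a, 'b) gorder_scheme \<Rightarrow> 'a set set" where
  "initial_segments P =
     {A. A \<subseteq> carrier P \<and> (\<forall>x \<in> carrier P. \<forall>y \<in> A. x \<sqsubseteq>\<^bsub>P\<^esub> y \<longrightarrow> x \<in> A)}"

definition initial_segment_lattice :: "('a, 'b) gorder_scheme \<Rightarrow> 'a set gorder" where
  "initial_segment_lattice P = \<lparr>carrier = initial_segments P, eq = (=), le = (\<subseteq>)\<rparr>"

text \<open>Join and meet below are those of the ambient structure \<^term>\<open>T\<close>, which is meant to be a
  lattice; otherwise they are unspecified.\<close>

definition sublattice :: "('a, 'b) gorder_scheme \<Rightarrow> 'a set \<Rightarrow> bool" where
  "sublattice T X \<longleftrightarrow> X \<subseteq> carrier T \<and>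
     (\<forall>x \<in> X. \<forall>y \<in> X. x \<squnion>\<^bsub>T\<^esub> y \<in> X \<and> x \<sqinter>\<^bsub>T\<^esub> y \<in> X)"

definition order_convex :: "('a, 'b) gorder_scheme \<Rightarrow> 'a set \<Rightarrow> bool" where
  "order_convex T X \<longleftrightarrow>
     (\<forall>x \<in> X. \<forall>y \<in> X. \<forall>z \<in> carrier T. x \<sqsubseteq>\<^bsub>T\<^esub> z \<and> z \<sqsubseteq>\<^bsub>T\<^esub> y \<longrightarrow> z \<in> X)"

definition bi_dominated :: "('a, 'b) gorder_scheme \<Rightarrow> 'a set \<Rightarrow> 'a set \<Rightarrow> bool" where
  "bi_dominated T X Y \<longleftrightarrow>
     (\<forall>x \<in> X. \<exists>y \<in> Y. x \<sqsubseteq>\<^bsub>T\<^esub> y) \<and> (\<forall>y \<in> Y. \<exists>x \<in> X. x \<sqsubseteq>\<^bsub>T\<^esub> y)"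

definition convex_sublattices :: "('a, 'b) gorder_scheme \<Rightarrow> 'a set gorder" where
  "convex_sublattices T =
     \<lparr>carrier = {X. X \<noteq> {} \<and> sublattice T X \<and> order_convex T X},
      eq = (=), le = bi_dominated T\<rparr>"

definition CLFPP :: "('a, 'b) gorder_scheme \<Rightarrow> bool" where
  "CLFPP T \<longleftrightarrow>
     (\<forall>f \<in> carrier T \<rightarrow> carrier (convex_sublattices T).
        monotone_on (carrier T) (le T) (le (convex_sublattices T)) f \<longrightarrow>
        (\<exists>x \<in> carrier T. x \<in> f x))"

definition CLSP :: "('a, 'b) gorder_scheme \<Rightarrow> bool" where
  "CLSP T \<longleftrightarrow>
     (\<exists>\<phi> \<in> carrier (convex_sublattices T) \<rightarrow> carrier T.
        monotone_on (carrier (convex_sublattices T)) (le (convex_sublattices T)) (le T) \<phi> \<and>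
        (\<forall>X \<in> carrier (convex_sublattices T). \<phi> X \<in> X))"

definition antichain :: "('a, 'b) gorder_scheme \<Rightarrow> 'a set \<Rightarrow> bool" where
  "antichain P A \<longleftrightarrow> A \<subseteq> carrier P \<and>
     (\<forall>x \<in> A. \<forall>y \<in> A. x \<noteq> y \<longrightarrow> \<not> x \<sqsubseteq>\<^bsub>P\<^esub> y)"

lemma least_Un_initial_segment_lattice:
  assumes "A \<in> initial_segments P" "B \<in> initial_segments P"
  shows "least (initial_segment_lattice P) (A \<union> B) (Upper (initial_segment_lattice P) {A, B})"
  using assms
  by (auto simp: least_def Upper_def initial_segment_lattice_def initial_segments_def)

lemma greatest_Int_initial_segment_lattice:
  assumes "A \<in> initial_segments P" "B \<in> initial_segments P"
  shows "greatest (initial_segment_lattice P) (A \<inter> B) (Lower (initial_segment_lattice P) {A, B})"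
  using assms
  by (auto simp: greatest_def Lower_def initial_segment_lattice_def initial_segments_def)

lemma lattice_initial_segment_lattice: "lattice (initial_segment_lattice P)"
proof -
  have c: "carrier (initial_segment_lattice P) = initial_segments P"
    by (simp add: initial_segment_lattice_def)
  have "partial_order (initial_segment_lattice P)"
    by unfold_locales (auto simp: initial_segment_lattice_def)
  then show ?thesis
    unfolding lattice_def upper_semilattice_def lower_semilattice_def
      upper_semilattice_axioms_def lower_semilattice_axioms_def c
    using least_Un_initial_segment_lattice greatest_Int_initial_segment_lattice by blast
qed

lemma partial_order_convex_sublattices:
  assumes "partial_order T"
  shows "partial_order (convex_sublattices T)"
proof -
  interpret T: partial_order T by fact
  have sub: "X \<subseteq> Y" if "bi_dominated T X Y" "bi_dominated T Y X"
    "sublattice T X" "sublattice T Y" "order_convex T Y" for X Y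
  proof
    fix x assume x: "x \<in> X"
    with that obtain y z where "y \<in> Y" "x \<sqsubseteq>\<^bsub>T\<^esub> y" "z \<in> Y" "z \<sqsubseteq>\<^bsub>T\<^esub> x"
      unfolding bi_dominated_def by meson
    with x that show "x \<in> Y"
      unfolding order_convex_def sublattice_def by blast
  qed
  have trans: "bi_dominated T X Z" if "bi_dominated T X Y" "bi_dominated T Y Z"
    "sublattice T X" "sublattice T Y" "sublattice T Z" for X Y Z
    using that T.le_trans unfolding bi_dominated_def sublattice_def by (meson subsetD)
  have refl: "bi_dominated T X X" if "sublattice T X" for X
    using that T.le_refl unfolding bi_dominated_def sublattice_def by blast
  show ?thesis
    by unfold_locales
      (use sub trans refl in \<open>auto simp: convex_sublattices_def\<close>)
qed

end

theory Submission
  imports Defs "HOL-Library.Nat_Bijection"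
begin

text \<open>
  (iv) implies (i). Fix a well-order of \<open>P\<close>. Shrink a convex sublattice \<open>X\<close> of \<open>\<I>(P)\<close> by running through
  the points \<open>q\<close> in this order: whenever some members of \<open>X\<close> contain \<open>q\<close> and others do not, keep
  only the members which contain \<open>q\<close> and no point strictly above \<open>q\<close>. Such a step is monotone in
  \<open>X\<close> and settles all points comparable to \<open>q\<close>. Hence the points at which a
  nontrivial step happens form an antichain, so there are only finitely many of them, nothing is
  lost at limits, and the process ends in a singleton.

  (i) implies (ii) is Knaster--Tarski. For (iv) implies (iii), a family without infimum yields a
  sequence of points forming an infinite antichain. Conversely, an infinite antichain, arranged in
  infinitely many infinite columns, gives a chain \<open>E 0 \<le> E 1 \<le> \<dots>\<close> and a monotone family \<open>G w\<close> of
  upper bounds of this chain such that no member of \<open>G w\<close> contains \<open>w\<close>. This refutes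
  both (ii) and (iii).
\<close>

section \<open>Convex sublattices of the lattice of initial segments\<close>

text \<open>The bi-dominating order for plain inclusion. It does not mention \<open>P\<close>, so
  comparisons need no lattice record.\<close>

definition bi_sub :: "'a set set \<Rightarrow> 'a set set \<Rightarrow> bool" where
  "bi_sub X Y \<longleftrightarrow> (\<forall>x\<in>X. \<exists>y\<in>Y. x \<subseteq> y) \<and> (\<forall>y\<in>Y. \<exists>x\<in>X. x \<subseteq> y)"

lemma bi_subI:
  assumes "\<And>x. x \<in> X \<Longrightarrow> \<exists>y\<in>Y. x \<subseteq> y" "\<And>y. y \<in> Y \<Longrightarrow> \<exists>x\<in>X. x \<subseteq> y"
  shows "bi_sub X Y"
  using assms by (simp add: bi_sub_def)

lemma bi_subD1: "bi_sub X Y \<Longrightarrow> x \<in> X \<Longrightarrow> \<exists>y\<in>Y. x \<subseteq> y"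
  and bi_subD2: "bi_sub X Y \<Longrightarrow> y \<in> Y \<Longrightarrow> \<exists>x\<in>X. x \<subseteq> y"
  by (auto simp: bi_sub_def)

definition init_clats :: "('a, 'b) gorder_scheme \<Rightarrow> 'a set set set" where
  "init_clats P = carrier (convex_sublattices (initial_segment_lattice P))"

lemma carrier_initial_segment_lattice [simp]:
  "carrier (initial_segment_lattice P) = initial_segments P"
  and le_initial_segment_lattice [simp]: "le (initial_segment_lattice P) = (\<subseteq>)"
  by (simp_all add: initial_segment_lattice_def)

lemma le_convex_sublattices [simp]:
  "le (convex_sublattices (initial_segment_lattice P)) = bi_sub"
  by (auto simp: fun_eq_iff convex_sublattices_def bi_dominated_def bi_sub_def)

lemma partial_order_initial_segment_lattice: "partial_order (initial_segment_lattice P)"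
  using lattice_initial_segment_lattice lattice.axioms(1) upper_semilattice.axioms(1) by blast

lemma join_initial_segment_lattice:
  assumes "A \<in> initial_segments P" "B \<in> initial_segments P"
  shows "A \<squnion>\<^bsub>initial_segment_lattice P\<^esub> B = A \<union> B"
proof -
  interpret partial_order "initial_segment_lattice P"
    by (rule partial_order_initial_segment_lattice)
  show ?thesis
    unfolding join_def sup_def
    using least_Un_initial_segment_lattice[OF assms]
    by (rule some_equality) (rule least_unique[OF _ least_Un_initial_segment_lattice[OF assms]])
qed

lemma meet_initial_segment_lattice:
  assumes "A \<in> initial_segments P" "B \<in> initial_segments P"
  shows "A \<sqinter>\<^bsub>initial_segment_lattice P\<^esub> B = A \<inter> B"
proof -
  interpret partial_order "initial_segment_lattice P"
    by (rule partial_order_initial_segment_lattice)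
  show ?thesis
    unfolding meet_def inf_def
    using greatest_Int_initial_segment_lattice[OF assms]
    by (rule some_equality) (rule greatest_unique[OF _ greatest_Int_initial_segment_lattice[OF assms]])
qed

lemma init_clats_iff:
  "X \<in> init_clats P \<longleftrightarrow> X \<noteq> {} \<and> X \<subseteq> initial_segments P \<and>
     (\<forall>x\<in>X. \<forall>y\<in>X. x \<union> y \<in> X \<and> x \<inter> y \<in> X) \<and>
     (\<forall>x\<in>X. \<forall>y\<in>X. \<forall>z\<in>initial_segments P. x \<subseteq> z \<and> z \<subseteq> y \<longrightarrow> z \<in> X)"
proof -
  have "(\<forall>x\<in>X. \<forall>y\<in>X. x \<squnion>\<^bsub>initial_segment_lattice P\<^esub> y \<in> X \<and> x \<sqinter>\<^bsub>initial_segment_lattice P\<^esub> y \<in> X) \<longleftrightarrow>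
      (\<forall>x\<in>X. \<forall>y\<in>X. x \<union> y \<in> X \<and> x \<inter> y \<in> X)" if "X \<subseteq> initial_segments P"
    using that
    by (intro ball_cong refl)
      (simp add: subset_iff join_initial_segment_lattice meet_initial_segment_lattice)
  then have "sublattice (initial_segment_lattice P) X \<longleftrightarrow>
      X \<subseteq> initial_segments P \<and> (\<forall>x\<in>X. \<forall>y\<in>X. x \<union> y \<in> X \<and> x \<inter> y \<in> X)"
    unfolding sublattice_def carrier_initial_segment_lattice by (rule conj_cong[OF refl])
  then show ?thesis
    by (simp add: init_clats_def convex_sublattices_def order_convex_def)
qed

lemma init_clatsI:
  assumes "x \<in> X" "X \<subseteq> initial_segments P"
    and "\<And>x y. x \<in> X \<Longrightarrow> y \<in> X \<Longrightarrow> x \<union> y \<in> X" "\<And>x y. x \<in> X \<Longrightarrow> y \<in> X \<Longrightarrow> x \<inter> y \<in> X"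
    and "\<And>x y z. x \<in> X \<Longrightarrow> y \<in> X \<Longrightarrow> z \<in> initial_segments P \<Longrightarrow> x \<subseteq> z \<Longrightarrow> z \<subseteq> y \<Longrightarrow> z \<in> X"
  shows "X \<in> init_clats P"
  unfolding init_clats_iff
proof (intro conjI ballI impI)
  show "X \<noteq> {}" using ex_in_conv assms(1) by metis
  fix x y assume "x \<in> X" "y \<in> X"
  then show "x \<union> y \<in> X" "x \<inter> y \<in> X"
    by (fact assms(3-4))+
  fix z assume "z \<in> initial_segments P" "x \<subseteq> z \<and> z \<subseteq> y"
  then show "z \<in> X"
    by (elim conjE) (rule assms(5)[OF \<open>x \<in> X\<close> \<open>y \<in> X\<close>])
qed (fact assms(2))

lemma init_clatsD:
  assumes "X \<in> init_clats P"
  shows "X \<noteq> {}" "X \<subseteq> initial_segments P"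
    and "x \<in> X \<Longrightarrow> y \<in> X \<Longrightarrow> x \<union> y \<in> X" "x \<in> X \<Longrightarrow> y \<in> X \<Longrightarrow> x \<inter> y \<in> X"
    and "x \<in> X \<Longrightarrow> y \<in> X \<Longrightarrow> z \<in> initial_segments P \<Longrightarrow> x \<subseteq> z \<Longrightarrow> z \<subseteq> y \<Longrightarrow> z \<in> X"
proof -
  note * = assms[unfolded init_clats_iff]
  show "X \<noteq> {}" "X \<subseteq> initial_segments P"
    by (rule *[THEN conjunct1]) (rule *[THEN conjunct2, THEN conjunct1])
  note lat = *[THEN conjunct2, THEN conjunct2, THEN conjunct1]
  note conv = *[THEN conjunct2, THEN conjunct2, THEN conjunct2]
  show "x \<union> y \<in> X" "x \<inter> y \<in> X" if "x \<in> X" "y \<in> X"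
    using bspec[OF bspec[OF lat that(1)] that(2)] by blast+
  show "z \<in> X" if "x \<in> X" "y \<in> X" "z \<in> initial_segments P" "x \<subseteq> z" "z \<subseteq> y"
    using bspec[OF bspec[OF bspec[OF conv that(1)] that(2)] that(3)] that(4,5) by blast
qed

text \<open>Intersecting the witnesses one by one stays inside \<open>X\<close>. Only finite
  \<open>S\<close> can be treated this way, which is why the infimum is later built from finite
  intersections.\<close>

lemma init_clats_finite_meet:
  assumes "X \<in> init_clats P" "finite S" "x0 \<in> X" "\<And>s. s \<in> S \<Longrightarrow> \<exists>x\<in>X. x \<subseteq> s"
  shows "\<exists>x\<in>X. x \<subseteq> x0 \<inter> \<Inter>S"
  using assms(2,4)
proof (induction S)
  case empty
  then show ?case using assms(3) by auto
next
  case (insert s S)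
  then obtain x y where "x \<in> X" "x \<subseteq> x0 \<inter> \<Inter>S" "y \<in> X" "y \<subseteq> s"
    by (metis insertCI)
  then show ?case
    using init_clatsD(4)[OF assms(1)] by (intro bexI[of _ "x \<inter> y"]) auto
qed

lemma initial_segmentsD:
  assumes "A \<in> initial_segments P"
  shows "A \<subseteq> carrier P" "y \<in> A \<Longrightarrow> x \<in> carrier P \<Longrightarrow> le P x y \<Longrightarrow> x \<in> A"
  using assms unfolding initial_segments_def by blast+

lemma initial_segments_Un:
  "A \<in> initial_segments P \<Longrightarrow> B \<in> initial_segments P \<Longrightarrow> A \<union> B \<in> initial_segments P"
  and initial_segments_Int:
  "A \<in> initial_segments P \<Longrightarrow> B \<in> initial_segments P \<Longrightarrow> A \<inter> B \<in> initial_segments P"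
  and initial_segments_Union:
  "\<A> \<subseteq> initial_segments P \<Longrightarrow> \<Union>\<A> \<in> initial_segments P"
  and initial_segments_Inter:
  "\<A> \<subseteq> initial_segments P \<Longrightarrow> carrier P \<inter> \<Inter>\<A> \<in> initial_segments P"
  and carrier_initial_segments: "carrier P \<in> initial_segments P"
  unfolding initial_segments_def by blast+

section \<open>Selection\<close>

definition undecided :: "'a \<Rightarrow> 'a set set \<Rightarrow> bool" where
  "undecided p X \<longleftrightarrow> (\<exists>x\<in>X. p \<in> x) \<and> (\<exists>x\<in>X. p \<notin> x)"

text \<open>The relation \<open>r\<close> is a strict well-order of the whole type, unrelated to the
  order of \<open>L\<close>; it fixes the sequence in which points are treated.\<close>

locale well_ordered_poset = partial_order L for L :: "('a, 'b) gorder_scheme" (structure) +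
  fixes r :: "'a rel"
  assumes wf_r: "wf r" and trans_r: "trans r" and total_r: "total r"
begin

definition restrict_at :: "'a set \<Rightarrow> 'a set set \<Rightarrow> 'a set set" where
  "restrict_at B X = {x \<in> X. \<forall>q\<in>B. q \<in> x \<and> (\<forall>u\<in>x. q \<sqsubseteq> u \<longrightarrow> u = q)}"

definition refine :: "'a \<Rightarrow> 'a set set \<Rightarrow> 'a set set" where
  "refine q X = (if undecided q X then restrict_at {q} X else X)"

text \<open>The points at which a nontrivial step happens. The recursion yields a truth value per
  point, \<open>f\<close> recording the earlier active ones; all earlier restrictions are imposed at
  once, so limits need no separate clause.\<close>

definition active :: "'a set set \<Rightarrow> 'a set" where
  "active X = {p. wfrec r (\<lambda>f p. p \<in> carrier L \<and> undecided p (restrict_at {q. (q, p) \<in> r \<and> f q} X)) p}"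

definition stage :: "'a set set \<Rightarrow> 'a set \<Rightarrow> 'a set set" where
  "stage X W = restrict_at (active X \<inter> W) X"

lemma restrict_at_insert: "restrict_at (insert q B) X = restrict_at {q} (restrict_at B X)"
  by (auto simp: restrict_at_def)

lemma active_iff: "p \<in> active X \<longleftrightarrow> p \<in> carrier L \<and> undecided p (stage X {q. (q, p) \<in> r})"
proof -
  let ?F = "\<lambda>f p. p \<in> carrier L \<and> undecided p (restrict_at {q. (q, p) \<in> r \<and> f q} X)"
  have "p \<in> active X \<longleftrightarrow> ?F (cut (wfrec r ?F) r p) p"
    unfolding active_def mem_Collect_eq using wfrec[OF wf_r, of ?F p] by blast
  \<comment> \<open>Below \<open>p\<close> the cut agrees with the recursion itself.\<close>
  also have "{q. (q, p) \<in> r \<and> cut (wfrec r ?F) r p q} = active X \<inter> {q. (q, p) \<in> r}"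
    by (auto simp: active_def cut_apply)
  finally show ?thesis
    by (simp add: stage_def)
qed

section \<open>A single refinement step\<close>

text \<open>The witness drops from \<open>x\<close> everything above \<open>q\<close> and adds the
  principal segment of \<open>q\<close>. With \<open>a\<close> containing \<open>q\<close> and
  \<open>b\<close> omitting it, the result lies between \<open>x \<inter> b\<close> and
  \<open>x \<union> a\<close>, so convexity keeps it in \<open>X\<close>.\<close>

lemma exchange_in_restrict_at:
  assumes X: "X \<in> init_clats L" and q: "q \<in> carrier L" "undecided q X" and x: "x \<in> X"
  shows "{u \<in> x. \<not> q \<sqsubseteq> u} \<union> {u \<in> carrier L. u \<sqsubseteq> q} \<in> restrict_at {q} X" (is "?s \<in> _")
proof -
  note D = init_clatsD[OF X]
  obtain a b where ab: "a \<in> X" "q \<in> a" "b \<in> X" "q \<notin> b"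
    using q(2) by (auto simp: undecided_def)
  have init: "a \<in> initial_segments L" "b \<in> initial_segments L" "x \<in> initial_segments L"
    using D(2) ab x by auto
  note I = init[THEN initial_segmentsD(1)]
  have "?s \<in> initial_segments L"
    using init(3) q(1) unfolding initial_segments_def by (auto intro: le_trans)
  moreover have "x \<inter> b \<subseteq> ?s"
    using initial_segmentsD(2)[OF init(2) _ q(1)] ab(4) by auto
  moreover have "?s \<subseteq> x \<union> a"
    using initial_segmentsD(2)[OF init(1) ab(2)] by auto
  ultimately have "?s \<in> X"
    using D(3-5) x ab by meson
  then show ?thesis
    using q(1) le_antisym by (auto simp: restrict_at_def)
qed

lemma refine_subset: "refine q X \<subseteq> X"
  by (auto simp: refine_def restrict_at_def)

text \<open>The exchanged set gives nonemptiness. Convexity survives because containing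
  \<open>q\<close> passes to larger sets, and having nothing strictly above \<open>q\<close> passes
  to smaller ones.\<close>

lemma refine_in_init_clats:
  assumes X: "X \<in> init_clats L" and q: "q \<in> carrier L"
  shows "refine q X \<in> init_clats L"
proof (cases "undecided q X")
  case True
  obtain x where "x \<in> X" using init_clatsD(1)[OF X] by blast
  note ex = exchange_in_restrict_at[OF X q True this]
  have mem: "z \<in> restrict_at {q} X \<longleftrightarrow> z \<in> X \<and> q \<in> z \<and> (\<forall>u\<in>z. q \<sqsubseteq> u \<longrightarrow> u = q)" for z
    by (simp add: restrict_at_def)
  have "restrict_at {q} X \<in> init_clats L"
  proof (rule init_clatsI[OF ex])
    show "restrict_at {q} X \<subseteq> initial_segments L"
      using init_clatsD(2)[OF X] by (auto simp: mem)
    fix x y assume xy: "x \<in> restrict_at {q} X" "y \<in> restrict_at {q} X"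
    then have "x \<in> X" "y \<in> X" by (auto simp: mem)
    note in_X = init_clatsD(3-5)[OF X this]
    show "x \<union> y \<in> restrict_at {q} X" "x \<inter> y \<in> restrict_at {q} X"
      using in_X(1,2) xy unfolding mem by blast+
    show "z \<in> restrict_at {q} X" if "z \<in> initial_segments L" "x \<subseteq> z" "z \<subseteq> y" for z
      using in_X(3)[OF that] xy that unfolding mem by blast
  qed
  with True show ?thesis by (simp add: refine_def)
next
  case False
  with X show ?thesis by (simp add: refine_def)
qed

text \<open>If \<open>Y\<close> is undecided at \<open>q\<close> and \<open>X\<close> is not, all
  members of \<open>X\<close> omit \<open>q\<close>; if \<open>X\<close> is undecided and
  \<open>Y\<close> is not, all members of \<open>Y\<close> contain \<open>q\<close>. Hence the
  exchanged set made from \<open>y\<close> still contains \<open>x\<close>, and the one made from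
  \<open>x\<close> still lies in \<open>y\<close>.\<close>

lemma refine_mono:
  assumes X: "X \<in> init_clats L" and Y: "Y \<in> init_clats L" and q: "q \<in> carrier L"
    and XY: "bi_sub X Y"
  shows "bi_sub (refine q X) (refine q Y)"
proof (rule bi_subI)
  fix x assume x: "x \<in> refine q X"
  then have "x \<in> X" using refine_subset by blast
  then obtain y where y: "y \<in> Y" "x \<subseteq> y"
    using bi_subD1[OF XY] by blast
  show "\<exists>y\<in>refine q Y. x \<subseteq> y"
  proof (cases "undecided q Y")
    case True
    have u: "u = q" if "u \<in> x" "q \<sqsubseteq> u" for u
    proof (cases "undecided q X")
      case True
      with x that show ?thesis by (auto simp: refine_def restrict_at_def)
    next
      case False
      obtain y' where "y' \<in> Y" "q \<notin> y'"
        using \<open>undecided q Y\<close> by (auto simp: undecided_def)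
      then obtain x' where "x' \<in> X" "q \<notin> x'"
        using bi_subD2[OF XY] by blast
      with False \<open>x \<in> X\<close> have "q \<notin> x"
        by (auto simp: undecided_def)
      moreover have "x \<in> initial_segments L"
        using init_clatsD(2)[OF X] \<open>x \<in> X\<close> by blast
      from initial_segmentsD(2)[OF this that(1) q that(2)] have "q \<in> x" .
      ultimately show ?thesis by contradiction
    qed
    have "x \<subseteq> {u \<in> y. \<not> q \<sqsubseteq> u} \<union> {u \<in> carrier L. u \<sqsubseteq> q}"
      using u y q by auto
    with exchange_in_restrict_at[OF Y q True y(1)] True show ?thesis
      unfolding refine_def by (metis (no_types, lifting))
  next
    case False
    with y show ?thesis by (auto simp: refine_def)
  qed
next
  fix y assume y: "y \<in> refine q Y"
  then have "y \<in> Y" using refine_subset by blast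
  then obtain x where x: "x \<in> X" "x \<subseteq> y"
    using bi_subD2[OF XY] by blast
  show "\<exists>x\<in>refine q X. x \<subseteq> y"
  proof (cases "undecided q X")
    case True
    have "q \<in> y"
    proof (cases "undecided q Y")
      case True
      with y show ?thesis by (auto simp: refine_def restrict_at_def)
    next
      case False
      obtain x' where "x' \<in> X" "q \<in> x'"
        using \<open>undecided q X\<close> by (auto simp: undecided_def)
      then obtain y' where "y' \<in> Y" "q \<in> y'"
        using bi_subD1[OF XY] by blast
      with False \<open>y \<in> Y\<close> show ?thesis
        by (auto simp: undecided_def)
    qed
    moreover have y_init: "y \<in> initial_segments L"
      using init_clatsD(2)[OF Y] \<open>y \<in> Y\<close> by blast
    ultimately have "{u \<in> x. \<not> q \<sqsubseteq> u} \<union> {u \<in> carrier L. u \<sqsubseteq> q} \<subseteq> y"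
      using initial_segmentsD(2)[OF y_init \<open>q \<in> y\<close>] x(2) by blast
    with exchange_in_restrict_at[OF X q True x(1)] True show ?thesis
      unfolding refine_def by (metis (no_types, lifting))
  next
    case False
    with x show ?thesis by (auto simp: refine_def)
  qed
qed

text \<open>Let \<open>a\<close> be treated before \<open>b\<close>. All sets left just before
  \<open>b\<close> have \<open>a\<close> as a maximal element. Since \<open>b\<close> is undecided,
  one of them contains \<open>b\<close>, which excludes \<open>a \<sqsubseteq> b\<close>, and one
  omits \<open>b\<close>, which excludes \<open>b \<sqsubseteq> a\<close>.\<close>

lemma antichain_active:
  assumes X: "X \<in> init_clats L"
  shows "antichain L (active X)"
proof -
  have no: "\<not> a \<sqsubseteq> b \<and> \<not> b \<sqsubseteq> a"
    if ab: "a \<in> active X" "b \<in> active X" "(a, b) \<in> r" for a b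
  proof -
    have ne: "a \<noteq> b" and b: "b \<in> carrier L"
      using ab wf_r by (auto simp: active_iff)
    obtain x y where x: "x \<in> stage X {q. (q, b) \<in> r}" "b \<in> x"
      and y: "y \<in> stage X {q. (q, b) \<in> r}" "b \<notin> y"
      using ab(2) by (auto simp: active_iff undecided_def)
    have "\<not> a \<sqsubseteq> b"
      using x ab ne unfolding stage_def restrict_at_def by blast
    moreover have "y \<in> initial_segments L" "a \<in> y"
      using y(1) ab init_clatsD(2)[OF X] unfolding stage_def restrict_at_def by blast+
    then have "\<not> b \<sqsubseteq> a"
      using initial_segmentsD(2)[of y L a b] y(2) b by blast
    ultimately show ?thesis by blast
  qed
  have "\<not> a \<sqsubseteq> b" if "a \<in> active X" "b \<in> active X" "a \<noteq> b" for a b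
    using no that total_r unfolding total_on_def by blast
  then show ?thesis
    by (auto simp: antichain_def active_iff)
qed

section \<open>Finitely many steps along the well-order\<close>

lemma finite_has_last:
  assumes "finite B" "B \<noteq> {}"
  shows "\<exists>q\<in>B. \<forall>b\<in>B. b = q \<or> (b, q) \<in> r"
  using assms
proof (induction rule: finite_ne_induct)
  case (singleton x)
  then show ?case by simp
next
  case (insert x B)
  then obtain q where q: "q \<in> B" "\<And>b. b \<in> B \<Longrightarrow> b = q \<or> (b, q) \<in> r" by blast
  show ?case
  proof (cases "x = q \<or> (x, q) \<in> r")
    case True
    with q show ?thesis by blast
  next
    case False
    then have "(q, x) \<in> r"
      using total_r by (auto simp: total_on_def)
    then have "b = x \<or> (b, x) \<in> r" if "b \<in> insert x B" for b
      using that q(2)[of b] transD[OF trans_r, of b q x] by blast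
    then show ?thesis by blast
  qed
qed

text \<open>The point \<open>q\<close> need not be active: then all active points of
  \<open>W\<close> come earlier and \<open>refine\<close> changes nothing. So two sublattices with
  different active points can be compared at the same \<open>q\<close>.\<close>

lemma stage_last:
  assumes q: "q \<in> carrier L" "q \<in> W" and last: "\<And>b. b \<in> active X \<inter> W \<Longrightarrow> b = q \<or> (b, q) \<in> r"
    and W: "\<And>p. (p, q) \<in> r \<Longrightarrow> p \<in> W"
  shows "stage X W = refine q (stage X {p. (p, q) \<in> r})"
proof -
  have "active X \<inter> W = (active X \<inter> {p. (p, q) \<in> r}) \<union> (if q \<in> active X then {q} else {})"
    using last W q(2) by auto
  moreover have "q \<in> active X \<longleftrightarrow> undecided q (stage X {p. (p, q) \<in> r})"
    using q(1) active_iff by simp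
  ultimately show ?thesis
    by (cases "q \<in> active X")
      (simp_all add: stage_def refine_def
        restrict_at_insert[of q "active X \<inter> {p. (p, q) \<in> r}"])
qed

text \<open>Induction on the number of points of \<open>W\<close> active for \<open>X\<close> or
  \<open>Y\<close>: the last such point is split off as one common refinement. Membership is carried
  along because \<open>refine_mono\<close> requires it.\<close>

lemma stage_mono:
  assumes X: "X \<in> init_clats L" and Y: "Y \<in> init_clats L" and XY: "bi_sub X Y"
    and fin: "finite (active X \<union> active Y)"
    and W: "\<And>p q. q \<in> W \<Longrightarrow> (p, q) \<in> r \<Longrightarrow> p \<in> W"
  shows "stage X W \<in> init_clats L \<and> stage Y W \<in> init_clats L \<and> bi_sub (stage X W) (stage Y W)"
  using W
proof (induction "card ((active X \<union> active Y) \<inter> W)" arbitrary: W rule: less_induct)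
  case less
  let ?B = "(active X \<union> active Y) \<inter> W"
  have finB: "finite ?B" using fin by blast
  show ?case
  proof (cases "?B = {}")
    case True
    then have "active X \<inter> W = {}" "active Y \<inter> W = {}" by auto
    then show ?thesis using X Y XY by (simp add: stage_def restrict_at_def)
  next
    case False
    then obtain q where q: "q \<in> ?B" and last: "\<And>b. b \<in> ?B \<Longrightarrow> b = q \<or> (b, q) \<in> r"
      using finite_has_last[OF finB] by blast
    \<comment> \<open>The points before the last step: again closed under predecessors, but without
      \<open>q\<close>.\<close>
    let ?V = "{p. (p, q) \<in> r}"
    have qc: "q \<in> carrier L" "q \<in> W" using q by (auto simp: active_iff)
    have VW: "p \<in> W" if "(p, q) \<in> r" for p
      using less.prems qc(2) that by blast
    have "(q, q) \<notin> r" using wf_r by auto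
    then have "(active X \<union> active Y) \<inter> ?V \<subset> ?B"
      using q VW by blast
    then have "card ((active X \<union> active Y) \<inter> ?V) < card ?B"
      using finB by (rule psubset_card_mono[rotated])
    moreover have "p \<in> ?V" if "p' \<in> ?V" "(p, p') \<in> r" for p p'
      using that trans_r by (auto dest: transD)
    ultimately have IH: "stage X ?V \<in> init_clats L" "stage Y ?V \<in> init_clats L"
      "bi_sub (stage X ?V) (stage Y ?V)"
      using less.hyps[of ?V] by blast+
    have "stage X W = refine q (stage X ?V)" "stage Y W = refine q (stage Y ?V)"
      using last VW by (intro stage_last qc; blast)+
    then show ?thesis
      using IH refine_in_init_clats refine_mono qc(1) by simp
  qed
qed

text \<open>An active point lies in every remaining set. An inactive one was already decided when
  its turn came, and the remaining sets all belong to that stage.\<close>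

lemma stage_UNIV_unique:
  assumes X: "X \<in> init_clats L" and x: "x \<in> stage X UNIV" and y: "y \<in> stage X UNIV"
  shows "x = y"
proof -
  have "p \<in> y" if x: "x \<in> stage X UNIV" and y: "y \<in> stage X UNIV" and p: "p \<in> x" for x y p
  proof (cases "p \<in> active X")
    case True
    with y show ?thesis by (auto simp: stage_def restrict_at_def)
  next
    case False
    have "x \<in> X" using x by (auto simp: stage_def restrict_at_def)
    then have "p \<in> carrier L"
      using init_clatsD(2)[OF X] initial_segmentsD(1)[of x] p by blast
    with False have "\<not> undecided p (stage X {q. (q, p) \<in> r})"
      by (simp add: active_iff)
    moreover have "x \<in> stage X {q. (q, p) \<in> r}" "y \<in> stage X {q. (q, p) \<in> r}"
      using x y by (auto simp: stage_def restrict_at_def)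
    ultimately show ?thesis
      using p by (auto simp: undecided_def)
  qed
  with x y show ?thesis by blast
qed

lemma CLSP_if_no_infinite_antichain_aux:
  assumes fac: "\<not> (\<exists>A. antichain L A \<and> infinite A)"
  shows "CLSP (initial_segment_lattice L)"
proof -
  define \<phi> where "\<phi> X = (SOME x. x \<in> stage X UNIV)" for X
  have fin: "finite (active X)" if "X \<in> init_clats L" for X
    using antichain_active[OF that] fac by blast
  have st: "stage X UNIV \<in> init_clats L \<and> stage Y UNIV \<in> init_clats L \<and> bi_sub (stage X UNIV) (stage Y UNIV)"
    if "X \<in> init_clats L" "Y \<in> init_clats L" "bi_sub X Y" for X Y
    using that fin by (intro stage_mono) auto
  have \<phi>: "\<phi> X \<in> stage X UNIV" if "X \<in> init_clats L" for X
  proof -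
    \<comment> \<open>Comparing \<open>X\<close> with itself makes the final stage a convex
      sublattice, hence nonempty.\<close>
    have "bi_sub X X" by (auto simp: bi_sub_def)
    then have "stage X UNIV \<noteq> {}"
      using st that init_clatsD(1) by blast
    then show ?thesis
      unfolding \<phi>_def by (simp add: some_in_eq)
  qed
  have in_X: "\<phi> X \<in> X" if "X \<in> init_clats L" for X
    using \<phi>[OF that] by (simp add: stage_def restrict_at_def)
  have "\<phi> X \<subseteq> \<phi> Y" if XY: "X \<in> init_clats L" "Y \<in> init_clats L" "bi_sub X Y" for X Y
  proof -
    obtain y where "y \<in> stage Y UNIV" "\<phi> X \<subseteq> y"
      using bi_subD1[OF _ \<phi>] st XY by blast
    then show ?thesis
      using stage_UNIV_unique \<phi> XY(2) by blast
  qed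
  then show ?thesis
    unfolding CLSP_def init_clats_def[symmetric] monotone_on_def
    using in_X init_clatsD(2)[THEN subsetD, OF _ in_X] by (intro bexI[of _ \<phi>]) auto
qed

end

lemma CLSP_if_no_infinite_antichain:
  assumes "partial_order P" "\<not> (\<exists>A. antichain P A \<and> infinite A)"
  shows "CLSP (initial_segment_lattice P)"
proof -
  obtain r :: "'a rel" where r: "Well_order r" "Field r = UNIV"
    using well_ordering[where 'a = 'a] by (elim exE conjE)
  then have "wf (r - Id)" and lin: "trans r" "antisym r" "total r"
    unfolding well_order_on_def linear_order_on_def partial_order_on_def preorder_on_def by simp_all
  moreover have "trans (r - Id)"
    using lin by (intro trans_diff_Id)
  moreover have "total (r - Id)"
    using lin by simp
  ultimately interpret well_ordered_poset P "r - Id"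
    using assms(1) by (intro well_ordered_poset.intro well_ordered_poset_axioms.intro)
  show ?thesis
    using assms(2) by (rule CLSP_if_no_infinite_antichain_aux)
qed

section \<open>From selection to fixed points\<close>

lemma CLFPP_if_CLSP:
  assumes "CLSP (initial_segment_lattice P)"
  shows "CLFPP (initial_segment_lattice P)"
  unfolding CLFPP_def init_clats_def[symmetric]
proof (intro ballI impI)
  let ?T = "initial_segments P"
  obtain \<phi> where mono_\<phi>: "\<And>X Y. X \<in> init_clats P \<Longrightarrow> Y \<in> init_clats P \<Longrightarrow> bi_sub X Y \<Longrightarrow> \<phi> X \<subseteq> \<phi> Y"
    and \<phi>: "\<And>X. X \<in> init_clats P \<Longrightarrow> \<phi> X \<in> X"
    using assms unfolding CLSP_def init_clats_def[symmetric] monotone_on_def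
      le_convex_sublattices le_initial_segment_lattice by (elim bexE conjE) metis
  fix f assume f: "f \<in> carrier (initial_segment_lattice P) \<rightarrow> init_clats P"
    and mono: "monotone_on (carrier (initial_segment_lattice P)) (le (initial_segment_lattice P))
      (le (convex_sublattices (initial_segment_lattice P))) f"
  \<comment> \<open>A monotone self-map of the complete lattice of initial segments. Its greatest
    fixed point \<open>x\<close> satisfies \<open>x = h x\<close>, and \<open>h x\<close> is
    selected from \<open>f x\<close>.\<close>
  define h where "h z = \<phi> (f z)" for z
  have h: "h z \<in> f z" "h z \<in> ?T" if "z \<in> ?T" for z
  proof -
    have "f z \<in> init_clats P" using that f by auto
    from \<phi>[OF this] init_clatsD(2)[OF this] show "h z \<in> f z" "h z \<in> ?T"
      unfolding h_def by blast+
  qed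
  have h_mono: "h z \<subseteq> h z'" if "z \<in> ?T" "z' \<in> ?T" "z \<subseteq> z'" for z z'
    using that mono f unfolding h_def monotone_on_def Pi_def by (intro mono_\<phi>) auto
  define x where "x = \<Union>{z \<in> ?T. z \<subseteq> h z}"
  have x: "x \<in> ?T"
    unfolding x_def by (rule initial_segments_Union) blast
  have "z \<subseteq> h x" if "z \<in> ?T" "z \<subseteq> h z" for z
  proof -
    have "z \<subseteq> x" using that by (auto simp: x_def)
    with h_mono[OF that(1) x] that show ?thesis by blast
  qed
  then have le: "x \<subseteq> h x"
    by (auto simp: x_def)
  have "h x \<subseteq> x"
    using h_mono[OF x _ le] h(2)[OF x] by (auto simp: x_def)
  with le h[OF x] x show "\<exists>x\<in>carrier (initial_segment_lattice P). x \<in> f x"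
    by auto
qed

section \<open>Infima of families of convex sublattices\<close>

text \<open>An ideal of initial segments that contains all members of every lower bound of the
  family.\<close>

definition lower_segments :: "('a, 'b) gorder_scheme \<Rightarrow> 'a set set set \<Rightarrow> 'a set set" where
  "lower_segments P \<X> = {y \<in> initial_segments P. \<forall>X\<in>\<X>. \<exists>x\<in>X. y \<subseteq> x}"

lemma lower_segments_init: "lower_segments P \<X> \<subseteq> initial_segments P"
  by (auto simp: lower_segments_def)

lemma lower_segmentsD: "y \<in> lower_segments P \<X> \<Longrightarrow> X \<in> \<X> \<Longrightarrow> \<exists>x\<in>X. y \<subseteq> x"
  by (simp add: lower_segments_def)

lemma lower_segments_down:
  "y \<in> lower_segments P \<X> \<Longrightarrow> z \<subseteq> y \<Longrightarrow> z \<in> initial_segments P \<Longrightarrow> z \<in> lower_segments P \<X>"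
  unfolding lower_segments_def by (auto intro: subset_trans) (metis subset_trans)

lemma lower_segments_Un:
  assumes XX: "\<X> \<subseteq> init_clats P" and ab: "a \<in> lower_segments P \<X>" "b \<in> lower_segments P \<X>"
  shows "a \<union> b \<in> lower_segments P \<X>"
proof -
  have "\<exists>c\<in>X. a \<union> b \<subseteq> c" if X: "X \<in> \<X>" for X
  proof -
    obtain a' b' where "a' \<in> X" "a \<subseteq> a'" "b' \<in> X" "b \<subseteq> b'"
      using lower_segmentsD[OF ab(1) X] lower_segmentsD[OF ab(2) X] by (elim bexE)
    moreover have "X \<in> init_clats P" using XX X by (rule subsetD)
    ultimately show ?thesis
      using init_clatsD(3)[of X P a' b'] by (intro bexI[of _ "a' \<union> b'"]) auto
  qed
  then show ?thesis
    using ab by (simp add: lower_segments_def initial_segments_Un)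
qed

text \<open>The set \<open>x\<close> serves as a greatest element of \<open>I\<close> up to
  intersection with finitely many sets from the family; the infimum is generated from it.\<close>

lemma infimum_base:
  fixes P :: "('a, 'b) gorder_scheme"
  assumes fac: "\<not> (\<exists>A. antichain P A \<and> infinite A)"
    and XX: "\<X> \<subseteq> init_clats P" "\<X> \<noteq> {}"
  defines "I \<equiv> lower_segments P \<X>"
  shows "\<exists>x\<in>I. \<forall>y\<in>I. \<exists>S. finite S \<and> S \<subseteq> \<Union>\<X> \<and> y \<inter> \<Inter>S \<subseteq> x"
proof (rule ccontr)
  assume "\<not> ?thesis"
  then have no: "\<forall>x\<in>I. \<exists>y\<in>I. \<forall>S. finite S \<and> S \<subseteq> \<Union>\<X> \<longrightarrow> \<not> y \<inter> \<Inter>S \<subseteq> x"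
    unfolding bex_simps(8) ball_simps(10) not_ex de_Morgan_conj imp_conv_disj by (simp only: disj_assoc)
  have init: "\<Union>\<X> \<subseteq> initial_segments P"
    using XX(1) init_clatsD(2) by blast
  have I_init: "I \<subseteq> initial_segments P"
    unfolding I_def by (rule lower_segments_init)
  have I_Un: "x \<union> y \<in> I" if "x \<in> I" "y \<in> I" for x y
    using lower_segments_Un[OF XX(1)] that unfolding I_def by blast
  \<comment> \<open>Build an increasing sequence \<open>x n\<close> in \<open>I\<close> and points \<open>p n\<close> entering at stage \<open>n\<close>. Since \<open>x n\<close> contains
    the earlier points, \<open>p n\<close> is not below them; since \<open>p n\<close> is also taken from members \<open>S n\<close> of the
    family omitting the earlier points, it is not above them.\<close>
  let ?y0 = "carrier P \<inter> \<Inter>(\<Union>\<X>)"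
  let ?R = "\<lambda>c. fst c \<in> I \<and> ?y0 \<subseteq> fst c \<and> finite (snd c) \<and> snd c \<subseteq> \<Union>\<X>"
  let ?Q = "\<lambda>x S x' S'. x \<subseteq> x' \<and> S \<subseteq> S' \<and> (\<exists>p\<in>x' \<inter> \<Inter>S. p \<in> carrier P \<and> p \<notin> x \<and> (\<exists>s\<in>S'. p \<notin> s))"
  have y0: "?y0 \<in> I"
  proof -
    have "\<exists>x\<in>X. ?y0 \<subseteq> x" if "X \<in> \<X>" for X
    proof -
      have "X \<noteq> {}" using init_clatsD(1) XX(1) that by (meson subsetD)
      then obtain x where "x \<in> X" by blast
      then show ?thesis using that by (intro bexI[of _ x]) auto
    qed
    then show ?thesis
      using initial_segments_Inter[OF init] by (simp add: I_def lower_segments_def)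
  qed
  have "\<exists>f. \<forall>n::nat. ?R (f n) \<and> ?Q (fst (f n)) (snd (f n)) (fst (f (Suc n))) (snd (f (Suc n)))"
  proof (rule dependent_nat_choice)
    show "\<exists>c. ?R c"
      using y0 by (intro exI[of _ "(?y0, {})"]) auto
  next
    fix c :: "'a set \<times> 'a set set" and n :: nat
    assume c: "?R c"
    then obtain y where y: "y \<in> I" "\<not> y \<inter> \<Inter>(snd c) \<subseteq> fst c"
      using no by metis
    then obtain p where p: "p \<in> y" "p \<in> \<Inter>(snd c)" "p \<notin> fst c" by blast
    have pc: "p \<in> carrier P"
      using y(1) p(1) I_init initial_segmentsD(1)[of y P] by blast
    then obtain s where s: "s \<in> \<Union>\<X>" "p \<notin> s"
      using c p(3) by blast
    show "\<exists>c'. ?R c' \<and> ?Q (fst c) (snd c) (fst c') (snd c')"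
      using c y(1) p pc s I_Un
      by (intro exI[of _ "(fst c \<union> y, insert s (snd c))"]) auto
  qed
  then obtain f where RQ: "\<forall>n. ?R (f n) \<and> ?Q (fst (f n)) (snd (f n)) (fst (f (Suc n))) (snd (f (Suc n)))"
    by (rule exE)
  define x S where "x n = fst (f n)" and "S n = snd (f n)" for n
  have f: "x n \<in> I" "S n \<subseteq> \<Union>\<X>" and step: "x n \<subseteq> x (Suc n)" "S n \<subseteq> S (Suc n)" for n
    using spec[OF RQ, of n] by (simp_all add: x_def S_def)
  have mono: "x n \<subseteq> x m" "S n \<subseteq> S m" if "n \<le> m" for n m
    using that lift_Suc_mono_le[of x] lift_Suc_mono_le[of S] step by simp_all
  have "\<forall>n. \<exists>p. p \<in> x (Suc n) \<and> p \<in> \<Inter>(S n) \<and> p \<in> carrier P \<and> p \<notin> x n \<and> (\<exists>s\<in>S (Suc n). p \<notin> s)"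
    using RQ unfolding x_def S_def by (simp only: Bex_def Int_iff) metis
  from choice[OF this] obtain p where "\<forall>n. p n \<in> x (Suc n) \<and> p n \<in> \<Inter>(S n) \<and> p n \<in> carrier P \<and>
      p n \<notin> x n \<and> (\<exists>s\<in>S (Suc n). p n \<notin> s)"
    by (rule exE)
  then have p: "p n \<in> x (Suc n)" "p n \<in> \<Inter>(S n)" "p n \<in> carrier P"
    "p n \<notin> x n" "\<exists>s\<in>S (Suc n). p n \<notin> s" for n
    by (metis (no_types))+
  have xi: "x n \<in> initial_segments P" for n
    using f(1) I_init by blast
  have cmp: "\<not> le P (p m) (p n) \<and> \<not> le P (p n) (p m)" and ne: "p m \<noteq> p n" if "m < n" for m n
  proof -
    \<comment> \<open>Both halves use \<open>Suc m \<le> n\<close>: the set \<open>s\<close>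
      omitting \<open>p m\<close> is already in \<open>S n\<close>, and \<open>p m\<close> is
      already in \<open>x n\<close>.\<close>
    obtain s where s: "s \<in> S (Suc m)" "p m \<notin> s" using p(5) by blast
    then have "s \<in> S n" using mono(2)[of "Suc m" n] that by auto
    then have "p n \<in> s" "s \<in> initial_segments P"
      using p(2)[of n] f(2)[of n] init by blast+
    then have "\<not> le P (p m) (p n)"
      using initial_segmentsD(2)[of s P "p n" "p m"] p(3) s(2) by blast
    moreover have "p m \<in> x n"
      using p(1) mono(1)[of "Suc m" n] that by auto
    then have "\<not> le P (p n) (p m)"
      using initial_segmentsD(2)[OF xi, of "p m" n "p n"] p(3,4) by blast
    ultimately show "\<not> le P (p m) (p n) \<and> \<not> le P (p n) (p m)" by blast
    show "p m \<noteq> p n" using \<open>p m \<in> x n\<close> p(4) by auto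
  qed
  have "inj p"
    using ne by (metis injI linorder_neqE_nat)
  then have "infinite (range p)"
    by (simp add: finite_image_iff)
  moreover have "antichain P (range p)"
    unfolding antichain_def using cmp p(3) by (auto) (metis linorder_neqE_nat)
  ultimately show False using fac by blast
qed

lemma complete_if_no_infinite_antichain:
  fixes P :: "('a, 'b) gorder_scheme"
  assumes fac: "\<not> (\<exists>A. antichain P A \<and> infinite A)"
  shows "complete_lattice (convex_sublattices (initial_segment_lattice P))" (is "complete_lattice ?C")
proof -
  interpret C: partial_order ?C
    by (intro partial_order_convex_sublattices partial_order_initial_segment_lattice)
  note [simp] = init_clats_def[symmetric]
  show ?thesis
  proof (rule C.complete_lattice_criterion1)
    have top: "{carrier P} \<in> init_clats P"
      using initial_segmentsD(1)
      by (intro init_clatsI[of "carrier P"]) (auto simp: carrier_initial_segments)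
    have "bi_sub X {carrier P}" if "X \<in> init_clats P" for X
    proof -
      have "X \<noteq> {}" using init_clatsD(1)[OF that] .
      moreover have "y \<subseteq> carrier P" if "y \<in> X" for y
        using init_clatsD(2)[OF \<open>X \<in> init_clats P\<close>] initial_segmentsD(1) that by (metis subsetD)
      ultimately show ?thesis by (auto simp: bi_sub_def)
    qed
    with top show "\<exists>g. greatest ?C g (carrier ?C)"
      by (auto simp: greatest_def)
  next
    fix \<X> assume "\<X> \<subseteq> carrier ?C" and ne: "\<X> \<noteq> {}"
    then have XX: "\<X> \<subseteq> init_clats P" by simp
    define I where "I = lower_segments P \<X>"
    obtain x where x: "x \<in> I" and
      min: "\<And>y. y \<in> I \<Longrightarrow> \<exists>S. finite S \<and> S \<subseteq> \<Union>\<X> \<and> y \<inter> \<Inter>S \<subseteq> x"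
      using infimum_base[OF fac XX ne] unfolding I_def by (elim bexE) metis
    note I_Un = lower_segments_Un[OF XX, folded I_def]
    have I_init: "I \<subseteq> initial_segments P"
      unfolding I_def by (rule lower_segments_init)
    have I_down: "a \<in> I" if "b \<in> I" "a \<subseteq> b" "a \<in> initial_segments P" for a b
      using that unfolding I_def by (rule lower_segments_down)
    \<comment> \<open>The infimum: the ideal \<open>I\<close> cut with the filter generated by the
      sets \<open>x \<inter> \<Inter>S\<close>, hence a convex sublattice.\<close>
    define M where "M = {z \<in> I. \<exists>S. finite S \<and> S \<subseteq> \<Union>\<X> \<and> x \<inter> \<Inter>S \<subseteq> z}"
    have MI: "M \<subseteq> I" and M_init: "M \<subseteq> initial_segments P"
      using I_init by (auto simp: M_def)
    have M_up: "z \<in> M" if "m \<in> M" "m \<subseteq> z" "z \<in> I" for m z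
      using that unfolding M_def by (simp, elim conjE exE) (metis subset_trans)
    have M_I: "z \<in> M" if "z \<in> I" "finite S" "S \<subseteq> \<Union>\<X>" "x \<inter> \<Inter>S \<subseteq> z" for z S
      using that unfolding M_def by auto
    have M_E: "\<exists>S. finite S \<and> S \<subseteq> \<Union>\<X> \<and> x \<inter> \<Inter>S \<subseteq> z" if "z \<in> M" for z
      using that by (simp add: M_def)
    have M_base: "x \<in> M"
      using x by (intro M_I[of _ "{}"]) auto
    have M: "M \<in> init_clats P"
    proof (rule init_clatsI[OF M_base M_init])
      fix a b assume ab: "a \<in> M" "b \<in> M"
      show "a \<union> b \<in> M"
        using ab MI by (intro M_up[OF ab(1)] I_Un) auto
      obtain S where S: "finite S" "S \<subseteq> \<Union>\<X>" "x \<inter> \<Inter>S \<subseteq> a"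
        using M_E[OF ab(1)] by (elim exE conjE)
      obtain S' where S': "finite S'" "S' \<subseteq> \<Union>\<X>" "x \<inter> \<Inter>S' \<subseteq> b"
        using M_E[OF ab(2)] by (elim exE conjE)
      have "a \<inter> b \<in> I"
        using I_down[OF subsetD[OF MI ab(1)] Int_lower1]
          initial_segments_Int[OF subsetD[OF M_init ab(1)] subsetD[OF M_init ab(2)]] .
      then show "a \<inter> b \<in> M"
        using S S' by (intro M_I[of _ "S \<union> S'"]) auto
      fix z assume "z \<in> initial_segments P" "a \<subseteq> z" "z \<subseteq> b"
      then show "z \<in> M"
        using M_up[OF ab(1)] I_down[OF subsetD[OF MI ab(2)]] by simp
    qed
    have "bi_sub M X" if X: "X \<in> \<X>" for X
    proof (rule bi_subI)
      fix m assume "m \<in> M"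
      then show "\<exists>a\<in>X. m \<subseteq> a" using lower_segmentsD[OF _ X] MI unfolding I_def by blast
    next
      fix a assume a: "a \<in> X"
      have "x \<inter> a \<in> I"
        using a X XX x I_init init_clatsD(2)[of X P]
        by (intro I_down[OF x] initial_segments_Int) auto
      then have "x \<inter> a \<in> M"
        using a X by (intro M_I[of _ "{a}"]) auto
      then show "\<exists>m\<in>M. m \<subseteq> a" by blast
    qed
    moreover have "bi_sub Y M" if Y: "Y \<in> init_clats P" and lower: "\<And>X. X \<in> \<X> \<Longrightarrow> bi_sub Y X" for Y
    proof -
      have YI: "Y \<subseteq> I"
      proof
        fix y assume "y \<in> Y"
        then show "y \<in> I"
          using init_clatsD(2)[OF Y] bi_subD1[OF lower] by (auto simp: I_def lower_segments_def)
      qed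
      show ?thesis
      proof (rule bi_subI)
        fix y assume "y \<in> Y"
        then have "x \<union> y \<in> M"
          using YI by (intro M_up[OF M_base] I_Un x) auto
        then show "\<exists>m\<in>M. y \<subseteq> m" by blast
      next
        fix m assume "m \<in> M"
        from M_E[OF this] obtain S where S: "finite S" "S \<subseteq> \<Union>\<X>" "x \<inter> \<Inter>S \<subseteq> m"
          by (elim exE conjE)
        \<comment> \<open>The sets in \<open>S'\<close> bring \<open>y0\<close> below
          \<open>x\<close>, and those in \<open>S\<close> then bring it below \<open>m\<close>.
          Together they are finitely many, each above a member of \<open>Y\<close>, so
          \<open>Y\<close> has a member below all of them.\<close>
        obtain y0 where y0: "y0 \<in> Y" using init_clatsD(1)[OF Y] by blast
        with YI have "y0 \<in> I" by blast
        from min[OF this] obtain S' where S': "finite S'" "S' \<subseteq> \<Union>\<X>" "y0 \<inter> \<Inter>S' \<subseteq> x"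
          by (elim exE conjE)
        have "\<exists>y\<in>Y. y \<subseteq> y0 \<inter> \<Inter>(S \<union> S')"
        proof (rule init_clats_finite_meet[OF Y _ y0])
          fix s assume "s \<in> S \<union> S'"
          then obtain X where "X \<in> \<X>" "s \<in> X"
            using S(2) S'(2) by blast
          then show "\<exists>y\<in>Y. y \<subseteq> s"
            using bi_subD2[OF lower] by blast
        qed (use S S' in simp)
        moreover have "y0 \<inter> \<Inter>(S \<union> S') \<subseteq> m" using S(3) S'(3) by blast
        ultimately show "\<exists>y\<in>Y. y \<subseteq> m" by (meson subset_trans)
      qed
    qed
    ultimately show "\<exists>i. greatest ?C i (Lower ?C \<X>)"
      using M XX by (intro exI[of _ M] greatest_LowerI) (auto simp: Lower_def)
  qed
qed

section \<open>Obstructions from an infinite antichain\<close>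

text \<open>A countable antichain arranged as a grid, with \<open>q j i\<close> the entry
  \<open>i\<close> of column \<open>j\<close>. By reflexivity \<open>q_le\<close> also makes the
  entries distinct.\<close>

locale antichain_columns = partial_order L for L :: "('a, 'b) gorder_scheme" (structure) +
  fixes q :: "nat \<Rightarrow> nat \<Rightarrow> 'a"
  assumes q_carrier: "q j i \<in> carrier L" and q_le: "q j i \<sqsubseteq> q j' i' \<Longrightarrow> j = j' \<and> i = i'"
begin

definition down :: "'a set \<Rightarrow> 'a set" where
  "down A = {u \<in> carrier L. \<exists>a\<in>A. u \<sqsubseteq> a}"

definition columns :: "nat \<Rightarrow> 'a set" where
  "columns k = down {q j i |j i. j \<le> k}"

text \<open>The condition on \<open>i'\<close> discards exactly the first point of \<open>w\<close>
  in each column.\<close>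

definition trim :: "'a set \<Rightarrow> 'a set" where
  "trim w = down {q j i |j i. q j i \<in> w \<and> (\<exists>i'<i. q j i' \<in> w)}"

definition almost :: "'a set \<Rightarrow> nat \<Rightarrow> bool" where
  "almost z j \<longleftrightarrow> finite {i. q j i \<notin> z}"

definition E :: "nat \<Rightarrow> 'a set set" where
  "E k = {z \<in> initial_segments L. (\<forall>j\<le>k. almost z j) \<and> z \<subseteq> columns k}"

text \<open>The exempted columns up to \<open>k\<close> make room for the members of each
  \<open>E k\<close>; beyond them the first points of \<open>w\<close> stay excluded.\<close>

definition G :: "'a set \<Rightarrow> 'a set set" where
  "G w = {z \<in> initial_segments L. (\<forall>j. almost z j) \<and> (\<exists>k. z \<subseteq> trim w \<union> columns k)}"

lemma down_init: "A \<subseteq> carrier L \<Longrightarrow> down A \<in> initial_segments L"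
  unfolding down_def initial_segments_def by auto (meson le_trans subsetD)

lemma columns_init: "columns k \<in> initial_segments L"
  and trim_init: "trim w \<in> initial_segments L"
  unfolding columns_def trim_def using q_carrier by (auto intro!: down_init)

lemma q_inj: "q j i = q j' i' \<Longrightarrow> j = j' \<and> i = i'"
  using q_le[of j i j' i'] q_carrier by simp

text \<open>By incomparability, the segment generated by grid points contains no further grid
  points.\<close>

lemma q_in_down:
  assumes A: "A \<subseteq> range (case_prod q)"
  shows "q j i \<in> down A \<longleftrightarrow> q j i \<in> A"
proof
  assume "q j i \<in> down A"
  then obtain a where "a \<in> A" "q j i \<sqsubseteq> a" by (auto simp: down_def)
  moreover from this obtain j' i' where "a = q j' i'" using A by auto
  ultimately show "q j i \<in> A" using q_le by metis
qed (use q_carrier in \<open>auto simp: down_def intro!: bexI\<close>)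

lemma q_in_columns: "q j i \<in> columns k \<longleftrightarrow> j \<le> k"
  unfolding columns_def by (subst q_in_down) (auto dest: q_inj)

lemma q_in_trim: "q j i \<in> trim w \<longleftrightarrow> q j i \<in> w \<and> (\<exists>i'<i. q j i' \<in> w)"
  unfolding trim_def by (subst q_in_down) (auto dest: q_inj)

lemma almost_mono: "almost z j \<Longrightarrow> z \<subseteq> z' \<Longrightarrow> almost z' j"
  unfolding almost_def by (erule finite_subset[rotated]) auto

lemma almost_Int: "almost z j \<Longrightarrow> almost z' j \<Longrightarrow> almost (z \<inter> z') j"
  unfolding almost_def by (erule (1) finite_subset[rotated, OF finite_UnI]) auto

lemma almost_columns: "j \<le> k \<Longrightarrow> almost (columns k) j"
  by (simp add: almost_def q_in_columns)

lemma almost_trim: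
  assumes "almost w j"
  shows "almost (trim w) j"
proof -
  have "infinite {i. q j i \<in> w}"
    using assms infinite_UNIV_nat finite_UnI[of "{i. q j i \<in> w}" "{i. q j i \<notin> w}"]
    by (auto simp: almost_def)
  then obtain i0 where i0: "q j i0 \<in> w"
    using not_finite_existsD by blast
  \<comment> \<open>Beyond row \<open>i0\<close>, every point of \<open>w\<close> in column
    \<open>j\<close> has an earlier one in \<open>w\<close> and survives trimming.\<close>
  have "{i. q j i \<notin> trim w} \<subseteq> {i. q j i \<notin> w} \<union> {..i0}"
    using i0 by (auto simp: q_in_trim not_less)
  then show ?thesis
    using assms finite_subset unfolding almost_def by blast
qed

lemma down_mono: "A \<subseteq> B \<Longrightarrow> down A \<subseteq> down B"
  unfolding down_def by blast

lemma columns_mono: "k \<le> k' \<Longrightarrow> columns k \<subseteq> columns k'"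
  unfolding columns_def by (rule down_mono) (use order.trans in blast)

lemma trim_mono: "w \<subseteq> w' \<Longrightarrow> trim w \<subseteq> trim w'"
  unfolding trim_def by (rule down_mono) blast

section \<open>The chain \<open>E\<close> and its upper bounds \<open>G w\<close>\<close>

lemma E_clat: "E k \<in> init_clats L"
proof (rule init_clatsI)
  show "columns k \<in> E k"
    by (simp add: E_def columns_init almost_columns)
qed (auto simp: E_def initial_segments_Un initial_segments_Int almost_Int
    intro: almost_mono)

lemma E_mono: "k \<le> k' \<Longrightarrow> bi_sub (E k) (E k')"
proof (rule bi_subI)
  fix z assume "k \<le> k'" "z \<in> E k"
  then show "\<exists>y\<in>E k'. z \<subseteq> y"
    using columns_mono[of k k']
    by (intro bexI[of _ "columns k'"]) (auto simp: E_def columns_init almost_columns)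
next
  fix z assume "k \<le> k'" "z \<in> E k'"
  then show "\<exists>y\<in>E k. y \<subseteq> z"
    by (intro bexI[of _ "z \<inter> columns k"])
      (auto simp: E_def columns_init almost_columns almost_Int initial_segments_Int)
qed

lemma G_clat:
  assumes "\<And>j. almost w j"
  shows "G w \<in> init_clats L"
proof (rule init_clatsI)
  show "trim w \<in> G w"
    using assms by (auto simp: G_def trim_init almost_trim)
  show "x \<union> y \<in> G w" if xy: "x \<in> G w" "y \<in> G w" for x y
  proof -
    obtain k k' where "x \<subseteq> trim w \<union> columns k" "y \<subseteq> trim w \<union> columns k'"
      using xy by (auto simp: G_def)
    then have "x \<union> y \<subseteq> trim w \<union> columns (max k k')"
      using columns_mono[of k "max k k'"] columns_mono[of k' "max k k'"] by auto
    with xy show ?thesis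
      unfolding G_def by (simp add: initial_segments_Un) (meson almost_mono Un_upper1)
  qed
  show "z \<in> G w" if "x \<in> G w" "y \<in> G w" "z \<in> initial_segments L" "x \<subseteq> z" "z \<subseteq> y" for x y z
    using that unfolding G_def by simp (meson almost_mono subset_trans)
qed (auto simp: G_def initial_segments_Int almost_Int)

text \<open>Members of \<open>G w\<close> already belong to \<open>G w'\<close>. Conversely, cutting
  a member of \<open>G w'\<close> with \<open>trim w\<close> costs only finitely many points per
  column.\<close>

lemma G_mono: "w \<subseteq> w' \<Longrightarrow> (\<And>j. almost w j) \<Longrightarrow> bi_sub (G w) (G w')"
proof (rule bi_subI)
  fix z assume w: "w \<subseteq> w'" "z \<in> G w"
  obtain k where "z \<subseteq> trim w \<union> columns k"
    using w(2) by (auto simp: G_def)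
  then have "z \<subseteq> trim w' \<union> columns k"
    using trim_mono[OF w(1)] by blast
  with w(2) show "\<exists>y\<in>G w'. z \<subseteq> y"
    by (intro bexI[of _ z]) (auto simp: G_def)
next
  fix z assume w: "w \<subseteq> w'" "\<And>j. almost w j" "z \<in> G w'"
  then show "\<exists>y\<in>G w. y \<subseteq> z"
    by (intro bexI[of _ "z \<inter> trim w"])
      (auto simp: G_def trim_init almost_trim almost_Int initial_segments_Int)
qed

text \<open>A member \<open>z\<close> of \<open>E k\<close> lives in exempted columns, so
  \<open>trim w \<union> z\<close> is in \<open>G w\<close>. Cutting a member of \<open>G w\<close>
  with \<open>columns k\<close> gives a member of \<open>E k\<close>.\<close>

lemma E_G:
  assumes "\<And>j. almost w j"
  shows "bi_sub (E k) (G w)"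
proof (rule bi_subI)
  fix z assume "z \<in> E k"
  then show "\<exists>y\<in>G w. z \<subseteq> y"
    using assms
    by (intro bexI[of _ "trim w \<union> z"])
      (auto simp: G_def E_def trim_init initial_segments_Un intro: almost_mono[OF almost_trim])
next
  fix z assume "z \<in> G w"
  then show "\<exists>y\<in>E k. y \<subseteq> z"
    by (intro bexI[of _ "z \<inter> columns k"])
      (auto simp: G_def E_def columns_init almost_columns almost_Int initial_segments_Int)
qed

text \<open>A member of \<open>G w\<close> misses the first point of \<open>w\<close> in all but finitely many columns.\<close>

lemma not_subset_G:
  assumes "\<And>j. almost w j" "z \<in> G w"
  shows "\<not> w \<subseteq> z"
proof
  assume sub: "w \<subseteq> z"
  obtain k where k: "z \<subseteq> trim w \<union> columns k"
    using assms(2) by (auto simp: G_def)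
  let ?j = "Suc k"
  have "{i. q ?j i \<notin> w} \<noteq> UNIV"
    using assms(1)[of ?j] infinite_UNIV_nat by (metis almost_def)
  then have "\<exists>i. q ?j i \<in> w" by blast
  then have *: "q ?j (LEAST i. q ?j i \<in> w) \<in> w" by (rule LeastI_ex)
  then have "q ?j (LEAST i. q ?j i \<in> w) \<in> trim w \<union> columns k"
    using sub k by blast
  then show False
    using not_less_Least by (auto simp: q_in_trim q_in_columns)
qed

section \<open>Failure of completeness and of the fixed point property\<close>

text \<open>A member \<open>w\<close> of a supremum of the chain contains almost all of every
  column, so \<open>G w\<close> is an upper bound too. Then some member of \<open>G w\<close> would
  contain \<open>w\<close>.\<close>

lemma not_complete: "\<not> complete_lattice (convex_sublattices (initial_segment_lattice L))"
proof
  let ?C = "convex_sublattices (initial_segment_lattice L)"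
  assume "complete_lattice ?C"
  then interpret C: complete_lattice ?C .
  note [simp] = init_clats_def[symmetric]
  obtain X where "least ?C X (Upper ?C (range E))"
    using C.sup_exists[of "range E"] E_clat by auto
  then have X: "X \<in> init_clats L" and up: "\<And>k. bi_sub (E k) X"
    and least: "\<And>Y. Y \<in> init_clats L \<Longrightarrow> (\<And>k. bi_sub (E k) Y) \<Longrightarrow> bi_sub X Y"
    by (auto simp: least_def Upper_def E_clat)
  obtain w where w: "w \<in> X"
    using init_clatsD(1)[OF X] by blast
  have almost: "almost w j" for j
    using bi_subD2[OF up[of j] w] almost_mono unfolding E_def by blast
  have "bi_sub X (G w)"
    using least G_clat E_G almost by blast
  then show False
    using bi_subD1[OF _ w] not_subset_G almost by blast
qed

lemma not_CLFPP: "\<not> CLFPP (initial_segment_lattice L)"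
proof
  assume fpp: "CLFPP (initial_segment_lattice L)"
  let ?T = "initial_segments L"
  \<comment> \<open>If \<open>z\<close> has a deficient column, the first one selects an
    \<open>E j\<close> whose members are not deficient there; otherwise no member of
    \<open>G z\<close> contains \<open>z\<close>. In both cases
    \<open>z \<notin> f z\<close>.\<close>
  define f where "f z = (if \<forall>j. almost z j then G z else E (LEAST j. \<not> almost z j))" for z
  have f: "f z \<in> init_clats L" for z
    by (simp add: f_def E_clat G_clat)
  have mono: "bi_sub (f z) (f z')" if "z \<subseteq> z'" for z z'
  proof (cases "\<forall>j. almost z' j")
    case True
    then show ?thesis
      using that by (auto simp: f_def G_mono E_G)
  next
    case False
    then have ex: "\<exists>j. \<not> almost z' j" by blast
    \<comment> \<open>Columns deficient for the larger set are deficient for the smaller one, so the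
      first deficient column can only move up as the set grows.\<close>
    then have *: "\<not> almost z (LEAST j. \<not> almost z' j)"
      using LeastI_ex[OF ex] almost_mono that by blast
    then have "(LEAST j. \<not> almost z j) \<le> (LEAST j. \<not> almost z' j)"
      by (rule Least_le)
    with * False show ?thesis
      by (auto simp: f_def intro: E_mono)
  qed
  have "\<exists>z\<in>?T. z \<in> f z"
    using fpp f mono unfolding CLFPP_def init_clats_def[symmetric] monotone_on_def by auto
  then obtain z where z: "z \<in> f z" by blast
  show False
  proof (cases "\<forall>j. almost z j")
    case True
    with z not_subset_G show ?thesis by (auto simp: f_def)
  next
    case False
    then have ex: "\<exists>j. \<not> almost z j" by blast
    have "z \<in> E (LEAST j. \<not> almost z j)"
      using z unfolding f_def if_not_P[OF False] .
    then have "almost z (LEAST j. \<not> almost z j)"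
      unfolding E_def by blast
    then show ?thesis
      using LeastI_ex[OF ex] by blast
  qed
qed

end

lemma infinite_antichain_columns:
  assumes "partial_order P" "antichain P A" "infinite A"
  shows "\<exists>q. antichain_columns P q"
proof -
  obtain s :: "nat \<Rightarrow> 'a" where s: "inj s" "range s \<subseteq> A"
    using infinite_countable_subset[OF assms(3)] by blast
  \<comment> \<open>The pairing bijection splits one sequence into infinitely many infinite
    columns.\<close>
  have "antichain_columns P (\<lambda>j i. s (prod_encode (j, i)))"
  proof (intro antichain_columns.intro antichain_columns_axioms.intro assms(1))
    show "s (prod_encode (j, i)) \<in> carrier P" for j i
      using s(2) assms(2) by (auto simp: antichain_def)
    show "j = j' \<and> i = i'" if "le P (s (prod_encode (j, i))) (s (prod_encode (j', i')))" for j i j' i'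
    proof -
      have "s (prod_encode (j, i)) = s (prod_encode (j', i'))"
        using that s(2) assms(2) unfolding antichain_def by blast
      then show ?thesis
        using s(1) by (simp add: inj_eq)
    qed
  qed
  then show ?thesis by blast
qed

theorem theorem2:
  fixes P :: "('a, 'b) gorder_scheme" and T :: "'a set gorder"
  assumes "partial_order P"
  defines "T \<equiv> initial_segment_lattice P"
  shows "(CLSP T \<longleftrightarrow> CLFPP T) \<and>
         (CLFPP T \<longleftrightarrow> complete_lattice (convex_sublattices T)) \<and>
         (complete_lattice (convex_sublattices T) \<longleftrightarrow> \<not> (\<exists>A. antichain P A \<and> infinite A))"
proof -
  have "\<not> CLFPP T \<and> \<not> complete_lattice (convex_sublattices T)" if "\<exists>A. antichain P A \<and> infinite A"
    using that infinite_antichain_columns[OF assms(1)] antichain_columns.not_CLFPP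
      antichain_columns.not_complete unfolding T_def by blast
  then show ?thesis
    using CLSP_if_no_infinite_antichain[OF assms(1)] CLFPP_if_CLSP complete_if_no_infinite_antichain
    unfolding T_def by blast
qed

end
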